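(* Let $p$ be an odd prime, let $\chi$ be the quadratic character modulo $p$ on $\mathbb F_p$, and let \[ T_p=\sum_{x\in\mathbb F_p}\chi(x^3-x). \] For $(\varepsilon_1,\varepsilon_2,\varepsilon_3)\in\{\pm1\}^3$ define \[ N(\varepsilon_1,\varepsilon_2,\varepsilon_3)=\#\{n\in\mathbb F_p:\ \chi(n-1)=\varepsilon_1,\ \chi(n)=\varepsilon_2,\ \chi(n+1)=\varepsilon_3\}. \] Then for every $(\varepsilon_1,\varepsilon_2,\varepsilon_3)\in\{\pm1\}^3$ the following hold. \begin{enumerate} \item If $p\equiv1\pmod8$, then \[ N(\varepsilon_1,\varepsilon_2,\varepsilon_3)=\frac18\Bigl(p-3-2\varepsilon_1-2\varepsilon_2-2\varepsilon_3-2\varepsilon_1\varepsilon_2-2\varepsilon_1\varepsilon_3-2\varepsilon_2\varepsilon_3+\varepsilon_1\varepsilon_2\varepsilon_3T_p\Bigr). \] \item If $p\equiv3\pmod8$, then \[ N(\varepsilon_1,\varepsilon_2,\varepsilon_3)=\frac18\Bigl(p-3+\varepsilon_1\varepsilon_2\varepsilon_3T_p\Bigr). \] \item If $p\equiv5\pmod8$, then \[ N(\varepsilon_1,\varepsilon_2,\varepsilon_3)=\frac18\Bigl(p-3-2\varepsilon_2-2\varepsilon_1\varepsilon_3+\varepsilon_1\varepsilon_2\varepsilon_3T_p\Bigr). \] \item If $p\equiv7\pmod8$, then \[ N(\varepsilon_1,\varepsilon_2,\varepsilon_3)=\frac18\Bigl(p-3+2\varepsilon_1-2\varepsilon_3-2\varepsilon_1\varepsilon_2-2\varepsilon_2\varepsilon_3+\varepsilon_1\varepsilon_2\varepsilon_3T_p\Bigr).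 \] \end{enumerate}
   Context: $\mathbb F_p=\mathbb Z/p\mathbb Z$. The quadratic character $\chi$ modulo $p$ (Legendre symbol) is the function $\chi:\mathbb F_p\to\{-1,0,1\}$ with $\chi(0)=0$, $\chi(x)=1$ if $x$ is a nonzero square in $\mathbb F_p$, and $\chi(x)=-1$ if $x$ is not a square in $\mathbb F_p$. Sums of values of $\chi$ (such as the Jacobsthal sum $T_p$) are taken in $\mathbb Z$. *)

theory Defs
  imports "HOL-Number_Theory.Number_Theory"
begin

(* The field with p elements is represented by the residues {0..<int p}. The quadratic character
   is the library's Legendre symbol on integers; Legendre a (int p) depends only on a mod p, so
   its arguments, such as x ^ 3 - x or n + 1, need not be reduced. *)

definition jacobsthal_sum :: "nat \<Rightarrow> int" where
  "jacobsthal_sum p = (\<Sum>x\<in>{0..<int p}. Legendre (x ^ 3 - x) (int p))"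

definition pattern_count :: "nat \<Rightarrow> int \<Rightarrow> int \<Rightarrow> int \<Rightarrow> nat" where
  "pattern_count p \<epsilon>\<^sub>1 \<epsilon>\<^sub>2 \<epsilon>\<^sub>3 =
     card {n \<in> {0..<int p}. Legendre (n - 1) (int p) = \<epsilon>\<^sub>1 \<and> Legendre n (int p) = \<epsilon>\<^sub>2 \<and>
                            Legendre (n + 1) (int p) = \<epsilon>\<^sub>3}"

end

theory Submission
  imports Defs
begin

text \<open>
  Expand \<open>(1 + \<epsilon>\<^sub>1 \<chi>(n - 1)) (1 + \<epsilon>\<^sub>2 \<chi>(n)) (1 + \<epsilon>\<^sub>3 \<chi>(n + 1))\<close> and sum over all residues \<open>n\<close>. Apart from
  the three residues -1, 0, 1, the product is 8 if \<open>n\<close> has the required pattern and 0 otherwise.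
  Linear character sums vanish, each product of two shifted characters sums to -1, and the triple
  product sums to the Jacobsthal sum; the three exceptional residues contribute terms depending
  only on \<open>\<chi>(-1)\<close> and \<open>\<chi>(2)\<close>, which the supplementary laws determine from \<open>p\<close> modulo 8.
\<close>

section \<open>Periodicity and values of the Legendre symbol\<close>

lemma Legendre_cong:
  assumes "[a = b] (mod m)"
  shows "Legendre a m = Legendre b m"
proof -
  have "[a = 0] (mod m) \<longleftrightarrow> [b = 0] (mod m)"
    using assms cong_sym cong_trans by blast
  moreover have "QuadRes m a \<longleftrightarrow> QuadRes m b"
    unfolding QuadRes_def using assms cong_sym cong_trans by blast
  ultimately show ?thesis by (simp add: Legendre_def)
qed

lemma Legendre_values: "Legendre a m \<in> {-1, 0, 1}"
  by (simp add: Legendre_def)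

lemma Legendre_eq_0_iff: "Legendre a m = 0 \<longleftrightarrow> m dvd a"
  by (simp add: Legendre_def cong_0_iff)

lemma Legendre_square: "Legendre a m * Legendre a m = (if m dvd a then 0 else 1)"
  using Legendre_values[of a m] Legendre_eq_0_iff[of a m] by auto

text \<open>Distinct elements of {-1, 0, 1} differ by at most 2, hence are incongruent modulo
  \<open>m > 2\<close>. This upgrades Euler's criterion from a congruence to an equation.\<close>

lemma Legendre_eqI:
  assumes "2 < m" "[Legendre a m = c] (mod m)" "c \<in> {-1, 0, 1}"
  shows "Legendre a m = c"
proof -
  have "m dvd (Legendre a m - c)"
    using assms(2) by (simp add: cong_iff_dvd_diff)
  moreover have "\<bar>Legendre a m - c\<bar> < m"
    using Legendre_values[of a m] assms by auto
  ultimately show ?thesis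
    using zdvd_not_zless[of "\<bar>Legendre a m - c\<bar>" m] by (cases "Legendre a m = c") auto
qed

text \<open>Multiplying by a unit and translating permutes the residues, and periodicity of
  \<open>f\<close> absorbs the reduction modulo \<open>p\<close>. Every change of variable in the
  character sums below is an instance.\<close>

lemma sum_residues_affine:
  fixes f :: "int \<Rightarrow> 'a::comm_monoid_add"
  assumes f: "\<And>x y. [x = y] (mod int p) \<Longrightarrow> f x = f y" and a: "coprime a (int p)" and "0 < p"
  shows "(\<Sum>x\<in>{0..<int p}. f (a * x + b)) = (\<Sum>x\<in>{0..<int p}. f x)"
proof -
  let ?g = "\<lambda>x. (a * x + b) mod int p"
  have inj: "inj_on ?g {0..<int p}"
  proof (rule inj_onI)
    fix x y assume xy: "x \<in> {0..<int p}" "y \<in> {0..<int p}" "?g x = ?g y"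
    then have "[a * x = a * y] (mod int p)"
      using cong_add_rcancel unfolding cong_def[symmetric] by blast
    then have "[x = y] (mod int p)" using a cong_mult_lcancel by blast
    with xy show "x = y" by (auto intro: cong_less_imp_eq_int)
  qed
  have "?g ` {0..<int p} = {0..<int p}"
    using inj \<open>0 < p\<close> by (intro endo_inj_surj) auto
  with inj have "bij_betw ?g {0..<int p} {0..<int p}" by (simp add: bij_betw_def)
  then have "(\<Sum>x\<in>{0..<int p}. f (?g x)) = (\<Sum>x\<in>{0..<int p}. f x)"
    by (rule sum.reindex_bij_betw)
  moreover have "f (?g x) = f (a * x + b)" for x by (rule f) simp
  ultimately show ?thesis by simp
qed

section \<open>Multiplicativity and the supplementary laws\<close>

lemma Legendre_mult:
  fixes p :: nat
  assumes p: "prime p" "2 < p"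
  shows "Legendre (a * b) p = Legendre a p * Legendre b p"
proof (rule Legendre_eqI)
  have "[Legendre (a * b) p = a ^ ((p - 1) div 2) * b ^ ((p - 1) div 2)] (mod p)"
    using euler_criterion[OF p, of "a * b"] by (simp add: power_mult_distrib)
  also have "[a ^ ((p - 1) div 2) * b ^ ((p - 1) div 2) = Legendre a p * Legendre b p] (mod p)"
    by (intro cong_mult cong_sym[OF euler_criterion] p)
  finally show "[Legendre (a * b) p = Legendre a p * Legendre b p] (mod p)" .
  show "Legendre a p * Legendre b p \<in> {-1, 0, 1}"
    using Legendre_values[of a p] Legendre_values[of b p] by auto
qed (use p in simp)

lemma Legendre_minus_1:
  fixes p :: nat
  assumes p: "prime p" "2 < p" and m: "p = 2 * m + 1"
  shows "Legendre (-1) p = (-1) ^ m"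
  using euler_criterion[OF p, of "-1"] p(2)
  by (intro Legendre_eqI) (auto simp: m minus_one_power_iff)

text \<open>By Gauss's lemma the exponent counts the doubles 2, 4, ..., 2m that exceed m = (p -
  1)/2; these come from m div 2 < x \<le> m.\<close>

lemma Legendre_2:
  fixes p :: nat
  assumes p: "prime p" "2 < p" and m: "p = 2 * m + 1"
  shows "Legendre 2 p = (-1) ^ (m - m div 2)"
proof -
  interpret GAUSS p 2
    using p by unfold_locales (auto simp: cong_0_iff dest: zdvd_imp_le)
  have h: "(int p - 1) div 2 = int m" "int p = 2 * int m + 1" by (simp_all add: m)
  \<comment> \<open>All doubles are at most 2m < p, so the reduction modulo \<open>p\<close> in
    \<open>C\<close> changes nothing.\<close>
  have "C = (\<lambda>x. x * 2) ` {0<..int m}"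
    unfolding C_def B_def A_def image_image h by (rule image_cong) simp_all
  then have "E = (\<lambda>x. x * 2) ` {int m div 2<..int m}"
    unfolding E_def h by auto
  then have "card E = card {int m div 2<..int m}"
    by (simp add: card_image inj_on_def)
  also have "\<dots> = m - m div 2"
    by (simp add: nat_diff_distrib nat_div_distrib)
  finally show ?thesis
    unfolding gauss_lemma by (rule arg_cong)
qed

section \<open>Complete sums of one and two characters\<close>

text \<open>Squaring sends both 1 and p - 1 to 1, so it is not injective on the finite set of
  residues and therefore misses one of them.\<close>

lemma ex_nonresidue:
  fixes p :: nat
  assumes p: "prime p" "2 < p"
  shows "\<exists>b. Legendre b p = -1"
proof -
  let ?R = "{0..<int p}" and ?sq = "\<lambda>x::int. x\<^sup>2 mod int p"
  have "(int p - 1)\<^sup>2 = 1 + int p * (int p - 2)"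
    by (simp add: power2_eq_square algebra_simps)
  then have "?sq (int p - 1) = ?sq 1" by simp
  then have "\<not> inj_on ?sq ?R"
    using p inj_onD[of ?sq ?R "int p - 1" 1] by auto
  then have "?sq ` ?R \<noteq> ?R"
    using finite_surj_inj[of ?R ?sq] by auto
  moreover have "?sq ` ?R \<subseteq> ?R" using p by auto
  ultimately obtain b where b: "b \<in> ?R" "b \<notin> ?sq ` ?R" by blast
  have "\<not> QuadRes p b"
  proof
    assume "QuadRes p b"
    then obtain y where "[y\<^sup>2 = b] (mod p)" by (auto simp: QuadRes_def)
    then have "?sq (y mod p) = b"
      using b(1) by (simp add: cong_def power_mod)
    moreover have "y mod p \<in> ?R" using p by simp
    ultimately show False using b(2) by blast
  qed
  moreover have "QuadRes p 0" by (auto simp: QuadRes_def intro: exI[of _ 0])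
  then have "b \<noteq> 0" using \<open>\<not> QuadRes p b\<close> by auto
  then have "\<not> [b = 0] (mod p)" using b(1) by (auto simp: cong_def)
  ultimately show ?thesis by (auto simp: Legendre_def)
qed

lemma coprime_if_not_dvd:
  fixes p :: nat
  assumes "prime p" and "\<not> int p dvd a"
  shows "coprime a (int p)"
  using assms prime_imp_coprime[of "int p" a] by (simp add: coprime_commute)

text \<open>Scaling the variable by a nonresidue permutes the residues but negates every term, so
  the full sum equals its own negative. A translation reduces general \<open>c\<close> to 0.\<close>

lemma sum_Legendre:
  fixes p :: nat
  assumes p: "prime p" "2 < p"
  shows "(\<Sum>x\<in>{0..<int p}. Legendre (x + c) p) = 0"
proof -
  let ?S = "\<Sum>x\<in>{0..<int p}. Legendre x p"
  obtain b where b: "Legendre b p = -1" using ex_nonresidue[OF p] by blast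
  then have "coprime b (int p)"
    using Legendre_eq_0_iff[of b p] by (intro coprime_if_not_dvd[OF p(1)]) auto
  then have "(\<Sum>x\<in>{0..<int p}. Legendre (b * x + 0) p) = ?S"
    using p by (intro sum_residues_affine Legendre_cong) auto
  then have "?S = 0" by (simp add: Legendre_mult[OF p] b sum_negf)
  moreover have "(\<Sum>x\<in>{0..<int p}. Legendre (1 * x + c) p) = ?S"
    using p by (intro sum_residues_affine Legendre_cong) auto
  ultimately show ?thesis by simp
qed

text \<open>
  Scaling shows that the correlation at distance \<open>c\<close> does not depend on \<open>c \<noteq> 0\<close>; the correlations
  at all distances add up to the square of the vanishing full character sum.
\<close>

lemma sum_Legendre_shift:
  fixes p :: nat
  assumes p: "prime p" "2 < p" and c: "\<not> int p dvd c"
  shows "(\<Sum>x\<in>{0..<int p}. Legendre x p * Legendre (x + c) p) = -1"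
proof -
  let ?R = "{0..<int p}"
  define S where "S c = (\<Sum>x\<in>?R. Legendre x p * Legendre (x + c) p)" for c
  have S: "S a = S 1" if a: "\<not> int p dvd a" for a
  proof -
    \<comment> \<open>After x is replaced by a x, both factors release \<chi>(a), and \<chi>(a)
      squared is 1. The \<open>+ 0\<close> matches the affine form of
      \<open>sum_residues_affine\<close>.\<close>
    have "S a = (\<Sum>x\<in>?R. Legendre (a * x + 0) p * Legendre (a * x + 0 + a) p)"
      unfolding S_def using p coprime_if_not_dvd[OF p(1) a]
      by (intro sum_residues_affine[symmetric] arg_cong2[of _ _ _ _ "(*)"] Legendre_cong
          cong_add) auto
    also have "\<dots> = (\<Sum>x\<in>?R. Legendre a p * Legendre a p * (Legendre x p * Legendre (x + 1) p))"
    proof (rule sum.cong)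
      fix x
      have "a * x + 0 + a = a * (x + 1)" by (simp add: algebra_simps)
      then show "Legendre (a * x + 0) p * Legendre (a * x + 0 + a) p =
          Legendre a p * Legendre a p * (Legendre x p * Legendre (x + 1) p)"
        by (simp only: Legendre_mult[OF p] add_0_right mult.assoc mult.left_commute)
    qed simp
    finally show ?thesis using a by (simp add: Legendre_square S_def)
  qed
  have R: "?R = insert 0 {1..<int p}" using p by auto
  have "S 0 = (\<Sum>x\<in>?R. if int p dvd x then 0 else 1)"
    by (simp add: S_def Legendre_square)
  also have "\<dots> = (\<Sum>x\<in>{1..<int p}. 1)"
    unfolding R by (auto simp: zdvd_not_zless intro!: sum.cong)
  finally have S0: "S 0 = int p - 1" using p by simp
  \<comment> \<open>With the order of summation exchanged, each inner sum is a translated full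
    character sum and vanishes.\<close>
  have "(\<Sum>a\<in>?R. S a) = (\<Sum>x\<in>?R. Legendre x p * (\<Sum>a\<in>?R. Legendre (a + x) p))"
    unfolding S_def by (subst sum.swap) (simp add: sum_distrib_left add.commute)
  then have "(\<Sum>a\<in>?R. S a) = 0" by (simp add: sum_Legendre[OF p])
  moreover have "(\<Sum>a\<in>?R. S a) = S 0 + (\<Sum>a\<in>{1..<int p}. S a)"
    unfolding R by simp
  moreover have "(\<Sum>a\<in>{1..<int p}. S a) = (\<Sum>a\<in>{1..<int p}. S 1)"
    by (rule sum.cong) (auto simp: zdvd_not_zless intro!: S)
  ultimately have "(int p - 1) * (S 1 + 1) = 0"
    using p S0 by (simp add: algebra_simps)
  then have "S 1 = -1" using p by simp
  then show ?thesis using S[OF c] by (simp add: S_def)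
qed

section \<open>Counting patterns in terms of \<chi>(-1) and \<chi>(2)\<close>

text \<open>Here \<open>s\<close> is \<chi>(-1) and \<open>t\<close> is \<chi>(2). The three
  subtracted products are the contributions of n = 0, 1 and p - 1, in this order. Leaving both signs
  symbolic serves all four classes modulo 8 at once.\<close>

lemma pattern_count_eq:
  fixes p :: nat
  assumes p: "prime p" "2 < p" and m: "p = 2 * m + 1"
    and \<epsilon>: "\<epsilon>\<^sub>1 \<in> {1, -1}" "\<epsilon>\<^sub>2 \<in> {1, -1}" "\<epsilon>\<^sub>3 \<in> {1, -1}"
  defines "s \<equiv> (-1) ^ m" and "t \<equiv> (-1) ^ (m - m div 2)"
  shows "8 * int (pattern_count p \<epsilon>\<^sub>1 \<epsilon>\<^sub>2 \<epsilon>\<^sub>3) =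
    int p - \<epsilon>\<^sub>1 * \<epsilon>\<^sub>2 - \<epsilon>\<^sub>1 * \<epsilon>\<^sub>3 - \<epsilon>\<^sub>2 * \<epsilon>\<^sub>3 + \<epsilon>\<^sub>1 * \<epsilon>\<^sub>2 * \<epsilon>\<^sub>3 * jacobsthal_sum p
    - (1 + \<epsilon>\<^sub>1 * s) * (1 + \<epsilon>\<^sub>3) - (1 + \<epsilon>\<^sub>2) * (1 + \<epsilon>\<^sub>3 * t) - (1 + \<epsilon>\<^sub>1 * s * t) * (1 + \<epsilon>\<^sub>2 * s)"
proof -
  let ?R = "{0..<int p}" and ?X = "{0, 1, int p - 1}"
  let ?\<chi> = "\<lambda>n. Legendre n p"
  define F where "F n = (1 + \<epsilon>\<^sub>1 * ?\<chi> (n - 1)) * (1 + \<epsilon>\<^sub>2 * ?\<chi> n) * (1 + \<epsilon>\<^sub>3 * ?\<chi> (n + 1))" for n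
  define P where "P n \<longleftrightarrow> ?\<chi> (n - 1) = \<epsilon>\<^sub>1 \<and> ?\<chi> n = \<epsilon>\<^sub>2 \<and> ?\<chi> (n + 1) = \<epsilon>\<^sub>3" for n
  have not_dvd: "\<not> int p dvd 1" "\<not> int p dvd 2"
    using p by (auto dest: zdvd_imp_le)
  have prod3: "?\<chi> (n - 1) * ?\<chi> n * ?\<chi> (n + 1) = ?\<chi> (n ^ 3 - n)" for n
    by (simp add: Legendre_mult[OF p, symmetric] power3_eq_cube algebra_simps)
  \<comment> \<open>Distances c = 1 and c = 2 handle the pairs (n - 1, n) and (n - 1, n +
    1).\<close>
  have shift: "(\<Sum>n\<in>?R. ?\<chi> (1 * n + - 1) * ?\<chi> (1 * n + - 1 + c)) = (\<Sum>n\<in>?R. ?\<chi> n * ?\<chi> (n + c))" for c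
    using p by (intro sum_residues_affine arg_cong2[of _ _ _ _ "(*)"] Legendre_cong cong_add) auto
  have F: "F n = 1 + \<epsilon>\<^sub>1 * ?\<chi> (n - 1) + \<epsilon>\<^sub>2 * ?\<chi> n + \<epsilon>\<^sub>3 * ?\<chi> (n + 1) + \<epsilon>\<^sub>1 * \<epsilon>\<^sub>2 * (?\<chi> (n - 1) * ?\<chi> n)
      + \<epsilon>\<^sub>1 * \<epsilon>\<^sub>3 * (?\<chi> (n - 1) * ?\<chi> (n + 1)) + \<epsilon>\<^sub>2 * \<epsilon>\<^sub>3 * (?\<chi> n * ?\<chi> (n + 1))
      + \<epsilon>\<^sub>1 * \<epsilon>\<^sub>2 * \<epsilon>\<^sub>3 * ?\<chi> (n ^ 3 - n)" for n
    unfolding F_def prod3[symmetric] by (simp add: algebra_simps)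
  have "(\<Sum>n\<in>?R. F n) = int p - \<epsilon>\<^sub>1 * \<epsilon>\<^sub>2 - \<epsilon>\<^sub>1 * \<epsilon>\<^sub>3 - \<epsilon>\<^sub>2 * \<epsilon>\<^sub>3 + \<epsilon>\<^sub>1 * \<epsilon>\<^sub>2 * \<epsilon>\<^sub>3 * jacobsthal_sum p"
    unfolding F
    using sum_Legendre[OF p, of "-1"] sum_Legendre[OF p, of 0] sum_Legendre[OF p, of 1]
      shift[of 1] shift[of 2]
      sum_Legendre_shift[OF p not_dvd(1)] sum_Legendre_shift[OF p not_dvd(2)]
    by (simp add: sum.distrib sum_distrib_left[symmetric] jacobsthal_sum_def add.commute)
  moreover have "(\<Sum>n\<in>?R. F n) = (\<Sum>n\<in>?R - ?X. F n) + (\<Sum>n\<in>?X. F n)"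
    using p by (intro sum.subset_diff) auto
  moreover have "(\<Sum>n\<in>?R - ?X. F n) = 8 * int (pattern_count p \<epsilon>\<^sub>1 \<epsilon>\<^sub>2 \<epsilon>\<^sub>3)"
  proof -
    have "F n = (if P n then 8 else 0)" if n: "n \<in> ?R - ?X" for n
    proof -
      have "\<not> int p dvd n - 1" "\<not> int p dvd n" "\<not> int p dvd n + 1"
        using n by (auto simp: zdvd_not_zless)
      then have "?\<chi> (n - 1) \<in> {1, -1}" "?\<chi> n \<in> {1, -1}" "?\<chi> (n + 1) \<in> {1, -1}"
        using Legendre_values[of _ p] Legendre_eq_0_iff[of _ p] by blast+
      moreover have "1 + \<epsilon> * x = (if x = \<epsilon> then 2 else 0)" if "x \<in> {1, -1}" "\<epsilon> \<in> {1, -1}" for x \<epsilon> :: int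
        using that by auto
      ultimately show ?thesis using \<epsilon> by (simp add: F_def P_def)
    qed
    then have "(\<Sum>n\<in>?R - ?X. F n) = (\<Sum>n\<in>?R - ?X. if P n then 8 else 0)" by simp
    also have "\<dots> = 8 * int (card ((?R - ?X) \<inter> {n. P n}))" by (simp add: sum.If_cases)
    \<comment> \<open>At each exceptional residue one of the three symbols is 0, which is no
      admissible sign, so excluding these residues loses no pattern.\<close>
    also have "(?R - ?X) \<inter> {n. P n} = {n \<in> ?R. P n}"
    proof -
      have "?\<chi> 0 = 0" "?\<chi> p = 0" by (simp_all add: Legendre_eq_0_iff)
      then have "\<not> P 0" "\<not> P 1" "\<not> P (int p - 1)" using \<epsilon> by (auto simp: P_def)
      then show ?thesis by blast
    qed
    finally show ?thesis by (simp add: pattern_count_def P_def)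
  qed
  moreover have "(\<Sum>n\<in>?X. F n) = (1 + \<epsilon>\<^sub>1 * s) * (1 + \<epsilon>\<^sub>3) + (1 + \<epsilon>\<^sub>2) * (1 + \<epsilon>\<^sub>3 * t)
      + (1 + \<epsilon>\<^sub>1 * s * t) * (1 + \<epsilon>\<^sub>2 * s)"
  proof -
    have "?\<chi> 0 = 0" "?\<chi> p = 0" by (simp_all add: Legendre_eq_0_iff)
    moreover have "?\<chi> 1 = 1"
      \<comment> \<open>\<chi>(1) is idempotent by multiplicativity, and nonzero.\<close>
      using Legendre_mult[OF p, of 1 1] not_dvd(1) Legendre_eq_0_iff[of 1 p] by auto
    moreover have s: "?\<chi> (-1) = s" and t: "?\<chi> 2 = t"
      unfolding s_def t_def using Legendre_minus_1[OF p m] Legendre_2[OF p m] by simp_all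
    moreover have "?\<chi> (int p - 1) = ?\<chi> (-1)"
      by (rule Legendre_cong) (simp add: cong_iff_dvd_diff)
    moreover have "?\<chi> (int p - 2) = ?\<chi> (-1 * 2)"
      by (rule Legendre_cong) (simp add: cong_iff_dvd_diff)
    then have "?\<chi> (int p - 2) = s * t" by (simp only: Legendre_mult[OF p] s t)
    ultimately show ?thesis
      using p by (simp add: F_def algebra_simps)
  qed
  ultimately show ?thesis by simp
qed

theorem theorem5:
  fixes p :: nat and \<epsilon>\<^sub>1 \<epsilon>\<^sub>2 \<epsilon>\<^sub>3 :: int
  assumes "prime p" and "odd p"
    and "\<epsilon>\<^sub>1 \<in> {1, -1}" and "\<epsilon>\<^sub>2 \<in> {1, -1}" and "\<epsilon>\<^sub>3 \<in> {1, -1}"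
  shows "([p = 1] (mod 8) \<longrightarrow>
           real (pattern_count p \<epsilon>\<^sub>1 \<epsilon>\<^sub>2 \<epsilon>\<^sub>3) =
             1 / 8 * real_of_int (int p - 3 - 2 * \<epsilon>\<^sub>1 - 2 * \<epsilon>\<^sub>2 - 2 * \<epsilon>\<^sub>3
               - 2 * \<epsilon>\<^sub>1 * \<epsilon>\<^sub>2 - 2 * \<epsilon>\<^sub>1 * \<epsilon>\<^sub>3 - 2 * \<epsilon>\<^sub>2 * \<epsilon>\<^sub>3
               + \<epsilon>\<^sub>1 * \<epsilon>\<^sub>2 * \<epsilon>\<^sub>3 * jacobsthal_sum p)) \<and>
         ([p = 3] (mod 8) \<longrightarrow>
           real (pattern_count p \<epsilon>\<^sub>1 \<epsilon>\<^sub>2 \<epsilon>\<^sub>3) =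
             1 / 8 * real_of_int (int p - 3 + \<epsilon>\<^sub>1 * \<epsilon>\<^sub>2 * \<epsilon>\<^sub>3 * jacobsthal_sum p)) \<and>
         ([p = 5] (mod 8) \<longrightarrow>
           real (pattern_count p \<epsilon>\<^sub>1 \<epsilon>\<^sub>2 \<epsilon>\<^sub>3) =
             1 / 8 * real_of_int (int p - 3 - 2 * \<epsilon>\<^sub>2 - 2 * \<epsilon>\<^sub>1 * \<epsilon>\<^sub>3
               + \<epsilon>\<^sub>1 * \<epsilon>\<^sub>2 * \<epsilon>\<^sub>3 * jacobsthal_sum p)) \<and>
         ([p = 7] (mod 8) \<longrightarrow>
           real (pattern_count p \<epsilon>\<^sub>1 \<epsilon>\<^sub>2 \<epsilon>\<^sub>3) =
             1 / 8 * real_of_int (int p - 3 + 2 * \<epsilon>\<^sub>1 - 2 * \<epsilon>\<^sub>3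
               - 2 * \<epsilon>\<^sub>1 * \<epsilon>\<^sub>2 - 2 * \<epsilon>\<^sub>2 * \<epsilon>\<^sub>3
               + \<epsilon>\<^sub>1 * \<epsilon>\<^sub>2 * \<epsilon>\<^sub>3 * jacobsthal_sum p))"
proof -
  have p: "prime p" "2 < p"
    using assms(1,2) prime_ge_2_nat[of p] by (auto simp: order_le_less)
  \<comment> \<open>Writing p = 8k + 2r + 1 gives m = 4k + r. Both signs depend only on
    \<open>r\<close>, so each class modulo 8 leaves just a polynomial identity with target
    \<open>z\<close>.\<close>
  have count: "real (pattern_count p \<epsilon>\<^sub>1 \<epsilon>\<^sub>2 \<epsilon>\<^sub>3) = 1 / 8 * real_of_int z"
    if "p mod 8 = 2 * r + 1"
      and "int p - \<epsilon>\<^sub>1 * \<epsilon>\<^sub>2 - \<epsilon>\<^sub>1 * \<epsilon>\<^sub>3 - \<epsilon>\<^sub>2 * \<epsilon>\<^sub>3 + \<epsilon>\<^sub>1 * \<epsilon>\<^sub>2 * \<epsilon>\<^sub>3 * jacobsthal_sum p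
        - (1 + \<epsilon>\<^sub>1 * (-1) ^ r) * (1 + \<epsilon>\<^sub>3) - (1 + \<epsilon>\<^sub>2) * (1 + \<epsilon>\<^sub>3 * (-1) ^ (r - r div 2))
        - (1 + \<epsilon>\<^sub>1 * (-1) ^ r * (-1) ^ (r - r div 2)) * (1 + \<epsilon>\<^sub>2 * (-1) ^ r) = z" for r z
  proof -
    define k where "k = p div 8"
    have m: "p = 2 * (4 * k + r) + 1"
      using that(1) div_mult_mod_eq[of p 8] by (simp add: k_def)
    \<comment> \<open>The contributions 4k and 2k of \<open>k\<close> to the two exponents are even
      and drop out.\<close>
    have "(4 * k + r) - (4 * k + r) div 2 = 2 * k + (r - r div 2)" by linarith
    then have "(-1::int) ^ ((4 * k + r) - (4 * k + r) div 2) = (-1) ^ (r - r div 2)"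
      and "(-1::int) ^ (4 * k + r) = (-1) ^ r"
      by (simp_all only: power_add power_mult) simp_all
    then have "8 * int (pattern_count p \<epsilon>\<^sub>1 \<epsilon>\<^sub>2 \<epsilon>\<^sub>3) = z"
      using pattern_count_eq[OF p m assms(3-5)] that(2) by (simp only:)
    from arg_cong[OF this, of real_of_int] show ?thesis by simp
  qed
  \<comment> \<open>For r = 0, 1, 2, 3 the pair (\<chi>(-1), \<chi>(2)) is (1, 1), (-1, -1), (1,
    -1), (-1, 1).\<close>
  show ?thesis
  proof (intro conjI impI, goal_cases)
    case 1
    then show ?case by (intro count[of 0]) (simp_all add: cong_def algebra_simps)
  next
    case 2
    then show ?case by (intro count[of 1]) (simp_all add: cong_def algebra_simps)
  next
    case 3
    then show ?case by (intro count[of 2]) (simp_all add: cong_def algebra_simps)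
  next
    case 4
    then show ?case by (intro count[of 3]) (simp_all add: cong_def algebra_simps)
  qed
qed

end
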